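(* Let $K$ be a field, let $X=\{x_1,\dots,x_n\}$, and let $I\subseteq P=K[X]$ be an ideal. Consider the following procedure. (1) Let $B$ be the empty list. (2) Compute a decomposition $I=I_1\cap\cdots\cap I_k$, where each $I_i$ is a $Y_i$-cellular ideal for some $Y_i\subseteq X$. (3) For every $x_i\in X\setminus\bigcap_{j=1}^kY_j$, let $\delta_i$ be the minimal positive integer such that $x_i^{\delta_i}\in I_j$ for all $j$ with $x_i\in X\setminus Y_j$. (4) For every subset $S\subseteq\{Y_1,\dots,Y_k\}$, let $Y=\bigcap_{Z\in S}Z$ (for $S=\emptyset$ this means $Y=X$) and perform steps (5)–(8). (5) Compute $M_Y=\bigcap_{i:\,Y\not\subseteq Y_i}\operatorname{Mon}(I_i)$ and $J_Y=\bigcap_{i:\,Y\subseteq Y_i}I_i$. (6) Compute the finite set $T_Y$ of all terms in $K[X\setminus Y]$ in which the exponent of $x_i$ is smaller than $\delta_i$ for all $x_i\in X\setminus Y$. (7) For each pair $s,t\in T_Y$ compute $\operatorname{Bin}_{s,t}(J_Y)$. (8) Add the elements of a generating set, consisting of monomials and binomials, of the ideal $M_Y\cap\sum_{s,t\in T_Y}\operatorname{Bin}_{s,t}(J_Y)$ to $B$. (9) Return $B$. Then the elements of the returned list $B$ generate the binomial part $\operatorname{Bin}(I)$ of $I$; that is, $$\operatorname{Bin}(I)=\sum_{Y}\Bigl(M_Y\cap\sum_{s,t\in T_Y}\operatorname{Bin}_{s,t}(J_Y)\Bigr),$$ where $Y$ ranges over all intersections of subsets of $\{Y_1,\dots,Y_k\}$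 (including the empty intersection $X$).
   Context: A term is a polynomial $x_1^{\alpha_1}\cdots x_n^{\alpha_n}$ with $\alpha_i\ge0$; a monomial is $at$ with $a\in K\setminus\{0\}$ and $t$ a term; a binomial is $as+bt$ with $a,b\in K\setminus\{0\}$ and $s,t$ terms. The binomial part $\operatorname{Bin}(I)$ is the ideal generated by all monomials and binomials contained in $I$; a binomial ideal is an ideal generated by monomials and binomials. The monomial part $\operatorname{Mon}(I)$ is the ideal generated by all monomials contained in $I$. For $Y\subseteq X$, an ideal $I\subseteq P$ is called $Y$-cellular if (a) $I=I:\langle\prod_{x_i\in Y}x_i\rangle^\infty$ and (b) for every $x_i\in X\setminus Y$ there is an integer $d_i>0$ with $x_i^{d_i}\in I$. Every ideal is a finite intersection of cellular ideals. For $Y\subseteq X$, an ideal $J\subseteq P$ with $J:\langle\prod_{x_i\in Y}x_i\rangle=J$, and terms $s,t\in K[X\setminus Y]$, the $(s,t)$-binomial part $\operatorname{Bin}_{s,t}(J)$ is the ideal of $P$ generated by all elements of $J$ of the form $su-avt$ with $a\in K$ and terms $u,v\in K[Y]$. An intersection over an empty index set of ideals of $P$ is $P$. *)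

theory Defs
  imports Complex_Main "HOL-Library.Poly_Mapping"
begin

text \<open>
  The set \<open>X\<close> of indeterminates is the universe of a type \<open>'x\<close> of class \<open>finite\<close>.  A term is
  represented by its exponent vector, and a polynomial maps exponent vectors to coefficients;
  multiplication of polynomials is the convolution product of \<^theory>\<open>HOL-Library.Poly_Mapping\<close>.
\<close>

type_synonym 'x expo = "'x \<Rightarrow>\<^sub>0 nat"
type_synonym ('x, 'k) mpoly = "('x \<Rightarrow>\<^sub>0 nat) \<Rightarrow>\<^sub>0 'k"

definition mono_poly :: "'k::zero \<Rightarrow> 'x expo \<Rightarrow> ('x, 'k) mpoly" where
  "mono_poly a t = Poly_Mapping.single t a"

definition Var :: "'x \<Rightarrow> ('x, 'k::zero_neq_one) mpoly" where
  "Var x = mono_poly 1 (Poly_Mapping.single x 1)"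

text \<open>Exponent vectors of the terms lying in \<open>K[Y]\<close>.\<close>

definition terms_in :: "'x set \<Rightarrow> 'x expo set" where
  "terms_in Y = {t. Poly_Mapping.keys t \<subseteq> Y}"

definition monomials :: "('x, 'k::zero) mpoly set" where
  "monomials = {mono_poly a t | a t. a \<noteq> 0}"

definition binomials :: "('x, 'k::comm_ring_1) mpoly set" where
  "binomials = {mono_poly a s + mono_poly b t | a b s t. a \<noteq> 0 \<and> b \<noteq> 0}"

text \<open>
  Ideals of a commutative ring are the submodules of the ring viewed as a module over itself:
  \<open>ideal.subspace I\<close> says that \<open>I\<close> is an ideal, and \<open>ideal.span G\<close> is the ideal generated by \<open>G\<close>.
\<close>

interpretation ideal: module "(*) :: 'a::comm_ring_1 \<Rightarrow> 'a \<Rightarrow> 'a"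
  by standard (simp_all add: algebra_simps)

text \<open>Sum of an arbitrary family of ideals: the smallest ideal containing all of them.\<close>

definition ideal_sum :: "('i \<Rightarrow> 'a::comm_ring_1 set) \<Rightarrow> 'i set \<Rightarrow> 'a set" where
  "ideal_sum F A = ideal.span (\<Union>i\<in>A. F i)"

definition ideal_prod :: "'a::comm_ring_1 set \<Rightarrow> 'a set \<Rightarrow> 'a set" where
  "ideal_prod I J = ideal.span {f * g | f g. f \<in> I \<and> g \<in> J}"

primrec ideal_power :: "'a::comm_ring_1 set \<Rightarrow> nat \<Rightarrow> 'a set" where
  "ideal_power I 0 = UNIV"
| "ideal_power I (Suc m) = ideal_prod I (ideal_power I m)"

definition colon :: "'a::comm_ring_1 set \<Rightarrow> 'a set \<Rightarrow> 'a set" where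
  "colon I J = {f. \<forall>g\<in>J. f * g \<in> I}"

definition saturation :: "'a::comm_ring_1 set \<Rightarrow> 'a set \<Rightarrow> 'a set" where
  "saturation I J = (\<Union>m. colon I (ideal_power J m))"

definition Bin :: "('x, 'k::comm_ring_1) mpoly set \<Rightarrow> ('x, 'k) mpoly set" where
  "Bin I = ideal.span (I \<inter> (monomials \<union> binomials))"

definition Mon :: "('x, 'k::comm_ring_1) mpoly set \<Rightarrow> ('x, 'k) mpoly set" where
  "Mon I = ideal.span (I \<inter> monomials)"

definition binomial_ideal :: "('x, 'k::comm_ring_1) mpoly set \<Rightarrow> bool" where
  "binomial_ideal I \<longleftrightarrow> (\<exists>G. G \<subseteq> monomials \<union> binomials \<and> I = ideal.span G)"

definition cellular :: "'x::finite set \<Rightarrow> ('x, 'k::comm_ring_1) mpoly set \<Rightarrow> bool" where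
  "cellular Y I \<longleftrightarrow> ideal.subspace I \<and>
     I = saturation I (ideal.span {\<Prod>x\<in>Y. Var x}) \<and>
     (\<forall>x. x \<notin> Y \<longrightarrow> (\<exists>d>0. Var x ^ d \<in> I))"

text \<open>
  Used only for ideals \<open>J\<close> with \<open>colon J (ideal.span {\<Prod>x\<in>Y. Var x}) = J\<close> and
  \<open>s, t \<in> terms_in (- Y)\<close>.  The scalar \<open>a\<close> may be \<open>0\<close>.
\<close>

definition Bin_st ::
  "'x set \<Rightarrow> 'x expo \<Rightarrow> 'x expo \<Rightarrow> ('x, 'k::comm_ring_1) mpoly set \<Rightarrow> ('x, 'k) mpoly set" where
  "Bin_st Y s t J = ideal.span
     (J \<inter> {mono_poly 1 (s + u) - mono_poly a (v + t) | a u v. u \<in> terms_in Y \<and> v \<in> terms_in Y})"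

text \<open>
  In the following, \<open>Is i\<close> and \<open>Ys i\<close> for \<open>i \<in> {1..k}\<close> are the cellular components and their sets
  of cell variables.  The value of \<open>delta\<close> is meaningful (and used) only for variables outside
  \<open>\<Inter>j\<in>{1..k}. Ys j\<close>; for cellular components the minimum then exists.  Empty
  intersections are \<open>UNIV\<close>, i.e. \<open>X\<close> for sets of variables and \<open>P\<close> for ideals.
\<close>

definition delta ::
  "nat \<Rightarrow> (nat \<Rightarrow> ('x, 'k::comm_ring_1) mpoly set) \<Rightarrow> (nat \<Rightarrow> 'x set) \<Rightarrow> 'x \<Rightarrow> nat" where
  "delta k Is Ys x = (LEAST d. 0 < d \<and> (\<forall>j\<in>{1..k}. x \<notin> Ys j \<longrightarrow> Var x ^ d \<in> Is j))"

definition M_part ::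
  "nat \<Rightarrow> (nat \<Rightarrow> ('x, 'k::comm_ring_1) mpoly set) \<Rightarrow> (nat \<Rightarrow> 'x set) \<Rightarrow> 'x set \<Rightarrow> ('x, 'k) mpoly set" where
  "M_part k Is Ys Y = (\<Inter>i\<in>{i\<in>{1..k}. \<not> Y \<subseteq> Ys i}. Mon (Is i))"

definition J_part ::
  "nat \<Rightarrow> (nat \<Rightarrow> ('x, 'k::comm_ring_1) mpoly set) \<Rightarrow> (nat \<Rightarrow> 'x set) \<Rightarrow> 'x set \<Rightarrow> ('x, 'k) mpoly set" where
  "J_part k Is Ys Y = (\<Inter>i\<in>{i\<in>{1..k}. Y \<subseteq> Ys i}. Is i)"

definition T_terms ::
  "nat \<Rightarrow> (nat \<Rightarrow> ('x, 'k::comm_ring_1) mpoly set) \<Rightarrow> (nat \<Rightarrow> 'x set) \<Rightarrow> 'x set \<Rightarrow> 'x expo set" where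
  "T_terms k Is Ys Y =
     {t \<in> terms_in (- Y). \<forall>x\<in>- Y. Poly_Mapping.lookup t x < delta k Is Ys x}"

definition step_ideal ::
  "nat \<Rightarrow> (nat \<Rightarrow> ('x, 'k::comm_ring_1) mpoly set) \<Rightarrow> (nat \<Rightarrow> 'x set) \<Rightarrow> 'x set \<Rightarrow> ('x, 'k) mpoly set" where
  "step_ideal k Is Ys Y = M_part k Is Ys Y \<inter>
     ideal_sum (\<lambda>(s, t). Bin_st Y s t (J_part k Is Ys Y)) (T_terms k Is Ys Y \<times> T_terms k Is Ys Y)"

text \<open>
  \<open>procedure_output k Is Ys B\<close>: the list \<open>B\<close> is returned by a run of the procedure on the
  decomposition given by \<open>Is\<close> and \<open>Ys\<close>.  The subsets \<open>S\<close> are processed in some order \<open>Ss\<close>, and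
  \<open>G S\<close> is the generating list that is chosen and appended for \<open>S\<close>.
\<close>

definition procedure_output ::
  "nat \<Rightarrow> (nat \<Rightarrow> ('x, 'k::comm_ring_1) mpoly set) \<Rightarrow> (nat \<Rightarrow> 'x set) \<Rightarrow> ('x, 'k) mpoly list \<Rightarrow> bool" where
  "procedure_output k Is Ys B \<longleftrightarrow>
     (\<exists>Ss G. distinct Ss \<and> set Ss = Pow (Ys ` {1..k}) \<and>
        (\<forall>S\<in>set Ss. set (G S) \<subseteq> monomials \<union> binomials \<and>
                    ideal.span (set (G S)) = step_ideal k Is Ys (\<Inter>S)) \<and>
        B = concat (map G Ss))"

end

theory Submission
  imports Defs
begin

text \<open>
  Write \<open>C\<^sub>Y\<close> for the ideal that the procedure treats for the set \<open>Y\<close>, that is, the intersection of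
  \<open>M_part\<close> with the sum of the ideals \<open>Bin_st\<close>.  The claim is that the ideals \<open>C\<^sub>Y\<close> sum to \<open>Bin I\<close>.

  Each \<open>C\<^sub>Y\<close> lies in \<open>Bin I\<close>.  It lies in \<open>I\<close>, because every component contains either \<open>M_part\<close> or
  \<open>J_part\<close> (\<open>step_ideal_subset\<close>).  That it is moreover generated by monomials and binomials is the one
  point that needs an argument: the intersection of a monomial ideal and a binomial ideal is a
  binomial ideal (\<open>monomial_inter_binomial\<close>).  For this it suffices that the support of a nonzero
  element of a binomial ideal always carries a monomial or a binomial of the ideal
  (\<open>two_terms_in_binomial_ideal\<close>), since subtracting multiples of such elements reduces any member
  of the intersection to zero without ever leaving the monomial ideal.

  Conversely, let \<open>s - a t\<close> with \<open>a \<noteq> 0\<close> be in \<open>I\<close>.  A component contains \<open>s\<close> if and only if it contains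
  \<open>t\<close>.  Take \<open>Y\<close> to be the intersection of the cell variable sets of those components that do not
  contain \<open>s\<close>.  Every component whose set does not include \<open>Y\<close> then contains both terms, so
  \<open>s - a t\<close> is in \<open>M_part\<close>.  A variable outside \<open>Y\<close> is nilpotent modulo some component that contains
  neither \<open>s\<close> nor \<open>t\<close>, so its exponents in \<open>s\<close> and \<open>t\<close> are below the bound \<open>delta\<close>.  Hence the parts of
  \<open>s\<close> and \<open>t\<close> outside \<open>Y\<close> belong to \<open>T_terms\<close>, and \<open>s - a t\<close> is one of the generators of the
  corresponding \<open>Bin_st\<close> (\<open>binomial_mem_some_step_ideal\<close>).  For a monomial of \<open>I\<close> the empty
  intersection \<open>Y = X\<close> does the same.
\<close>

section \<open>Monomials and binomials\<close>

lemma mono_poly_0 [simp]: "mono_poly 0 t = 0"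
  by (simp add: mono_poly_def)

lemma mono_poly_mult: "mono_poly a s * mono_poly b t = mono_poly (a * b) (s + t)"
  by (simp add: mono_poly_def mult_single)

lemma mono_poly_diff: "mono_poly a t - mono_poly b t = mono_poly (a - b) t"
  by (simp add: mono_poly_def single_diff)

lemma mono_poly_uminus: "mono_poly (- a) t = - mono_poly a t"
  by (simp add: mono_poly_def single_uminus)

lemma lookup_mono_poly: "Poly_Mapping.lookup (mono_poly a s) t = (a when s = t)"
  by (simp add: mono_poly_def lookup_single)

lemma mono_poly_sum: "f = (\<Sum>t\<in>Poly_Mapping.keys f. mono_poly (Poly_Mapping.lookup f t) t)"
  by (rule poly_mapping_eqI)
    (simp add: lookup_sum lookup_mono_poly when_def not_in_keys_iff_lookup_eq_zero)

lemma ideal_coeff_mono_poly: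
  fixes a :: "'k::field"
  assumes "ideal.subspace J" "mono_poly a t \<in> J" "a \<noteq> 0"
  shows "mono_poly b t \<in> J"
proof -
  have "mono_poly (b / a) 0 * mono_poly a t \<in> J"
    using assms by (intro ideal.subspace_scale)
  then show ?thesis using assms(3) by (simp add: mono_poly_mult)
qed

text \<open>
  The scalar may vanish, in which case the difference is a monomial.  This form therefore treats
  monomials and binomials together, and it is the form of the generators of \<open>Bin_st\<close>.
\<close>

lemma normalized_difference_mem:
  fixes a :: "'k::field"
  shows "mono_poly 1 p - mono_poly a q \<in> monomials \<union> binomials"
proof (cases "a = 0")
  case True
  then show ?thesis by (auto simp: monomials_def)
next
  case False
  have "mono_poly 1 p - mono_poly a q = mono_poly 1 p + mono_poly (- a) q"
    by (simp add: mono_poly_uminus)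
  moreover have "- a \<noteq> 0" "(1::'k) \<noteq> 0" using False by simp_all
  ultimately show ?thesis unfolding binomials_def by blast
qed

lemma binomial_ideal_subspace: "binomial_ideal B \<Longrightarrow> ideal.subspace B"
  by (auto simp: binomial_ideal_def)

lemma binomial_or_monomial_mult_mono_poly:
  fixes a :: "'k::field"
  assumes "g \<in> monomials \<union> binomials" "a \<noteq> 0"
  shows "mono_poly a t * g \<in> monomials \<union> binomials"
proof -
  consider b s where "g = mono_poly b s" "b \<noteq> 0"
    | b c r s where "g = mono_poly b r + mono_poly c s" "b \<noteq> 0" "c \<noteq> 0"
    using assms(1) by (auto simp: monomials_def binomials_def)
  then show ?thesis
  proof cases
    case 1
    then have "mono_poly a t * g = mono_poly (a * b) (t + s)" "a * b \<noteq> 0"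
      using assms(2) by (simp_all add: mono_poly_mult)
    then show ?thesis unfolding monomials_def by blast
  next
    case 2
    then have "mono_poly a t * g = mono_poly (a * b) (t + r) + mono_poly (a * c) (t + s)"
        "a * b \<noteq> 0" "a * c \<noteq> 0"
      using assms(2) by (simp_all add: mono_poly_mult distrib_left)
    then show ?thesis unfolding binomials_def by blast
  qed
qed

section \<open>Small supports in binomial ideals\<close>

definition lin_ext :: "('x expo \<Rightarrow> 'k) \<Rightarrow> ('x, 'k::comm_ring_1) mpoly \<Rightarrow> 'k" where
  "lin_ext \<phi> f = (\<Sum>t\<in>Poly_Mapping.keys f. Poly_Mapping.lookup f t * \<phi> t)"

lemma lin_ext_superset:
  assumes "finite A" "Poly_Mapping.keys f \<subseteq> A"
  shows "lin_ext \<phi> f = (\<Sum>t\<in>A. Poly_Mapping.lookup f t * \<phi> t)"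
  unfolding lin_ext_def using assms
  by (intro sum.mono_neutral_left) (auto simp: not_in_keys_iff_lookup_eq_zero)

lemma lin_ext_add: "lin_ext \<phi> (f + g) = lin_ext \<phi> f + lin_ext \<phi> g"
proof -
  let ?A = "Poly_Mapping.keys f \<union> Poly_Mapping.keys g"
  have "lin_ext \<phi> (f + g) = (\<Sum>t\<in>?A. Poly_Mapping.lookup (f + g) t * \<phi> t)"
    using keys_add[of f g] by (intro lin_ext_superset) auto
  also have "\<dots> = (\<Sum>t\<in>?A. Poly_Mapping.lookup f t * \<phi> t) + (\<Sum>t\<in>?A. Poly_Mapping.lookup g t * \<phi> t)"
    by (simp add: lookup_add distrib_right sum.distrib)
  also have "\<dots> = lin_ext \<phi> f + lin_ext \<phi> g"
    by (simp add: lin_ext_superset[of ?A])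
  finally show ?thesis .
qed

lemma lin_ext_0 [simp]: "lin_ext \<phi> 0 = 0"
  by (simp add: lin_ext_def)

lemma lin_ext_sum: "lin_ext \<phi> (\<Sum>i\<in>A. f i) = (\<Sum>i\<in>A. lin_ext \<phi> (f i))"
  by (induction A rule: infinite_finite_induct) (simp_all add: lin_ext_add)

lemma lin_ext_mono_poly: "lin_ext \<phi> (mono_poly a t) = a * \<phi> t"
  by (simp add: lin_ext_def mono_poly_def)

text \<open>
  As a vector space, a binomial ideal is spanned by the monomial multiples of its generators, and
  these are again monomials and binomials of the ideal.
\<close>

lemma lin_ext_vanishes_on_binomial_ideal:
  fixes B :: "('x, 'k::field) mpoly set"
  assumes "binomial_ideal B"
    and van: "\<And>g. g \<in> B \<inter> (monomials \<union> binomials) \<Longrightarrow> lin_ext \<phi> g = 0"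
    and "f \<in> B"
  shows "lin_ext \<phi> f = 0"
proof -
  obtain G where G: "G \<subseteq> monomials \<union> binomials" "B = ideal.span G"
    using assms(1) by (auto simp: binomial_ideal_def)
  have single: "lin_ext \<phi> (mono_poly a t * g) = 0" if "g \<in> G" for a t g
  proof (cases "a = 0")
    case False
    have "mono_poly a t * g \<in> B"
      using that G(2) by (simp add: ideal.span_base ideal.span_scale)
    moreover have "mono_poly a t * g \<in> monomials \<union> binomials"
      using that G(1) False by (intro binomial_or_monomial_mult_mono_poly) auto
    ultimately show ?thesis by (intro van IntI)
  qed simp
  have gen: "lin_ext \<phi> (c * g) = 0" if "g \<in> G" for c g
  proof -
    have "c * g = (\<Sum>t\<in>Poly_Mapping.keys c. mono_poly (Poly_Mapping.lookup c t) t * g)"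
      by (subst mono_poly_sum[of c]) (rule sum_distrib_right)
    then show ?thesis by (simp add: lin_ext_sum single that)
  qed
  from \<open>f \<in> B\<close> have "f \<in> ideal.span G" using G(2) by simp
  then show ?thesis
    by (induction rule: ideal.span_induct_alt) (simp_all add: lin_ext_add gen)
qed

text \<open>
  Reducing each term modulo \<open>B\<close> to a scalar multiple of \<open>s\<close>, where that is possible, and to \<open>0\<close>
  otherwise gives a linear functional that vanishes on \<open>B\<close>; the scalars are unique because \<open>s\<close> is not
  in \<open>B\<close>.  If no other term of \<open>f\<close> were congruent
  to a multiple of \<open>s\<close>, its value at \<open>f\<close> would be the nonzero coefficient of \<open>s\<close> in \<open>f\<close>.
\<close>

lemma two_terms_in_binomial_ideal:
  fixes B :: "('x, 'k::field) mpoly set"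
  assumes B: "binomial_ideal B" and f: "f \<in> B" and s: "s \<in> Poly_Mapping.keys f" "mono_poly 1 s \<notin> B"
  shows "\<exists>t\<in>Poly_Mapping.keys f - {s}. \<exists>a. mono_poly 1 t - mono_poly a s \<in> B"
proof (rule ccontr)
  assume contra: "\<not> ?thesis"
  note sub = binomial_ideal_subspace[OF B]
  define R where "R t a \<longleftrightarrow> mono_poly 1 t - mono_poly a s \<in> B" for t a
  have only_zero: "c = 0" if "mono_poly c s \<in> B" for c
    using ideal_coeff_mono_poly[OF sub that, of 1] s(2) by blast
  have R_unique: "a = b" if "R t a" "R t b" for t a b
  proof -
    have "(mono_poly 1 t - mono_poly b s) - (mono_poly 1 t - mono_poly a s) \<in> B"
      using that unfolding R_def by (rule ideal.subspace_diff[OF sub, rotated])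
    then have "mono_poly (a - b) s \<in> B" by (simp flip: mono_poly_diff)
    then show ?thesis using only_zero by force
  qed
  have scaled: "mono_poly b t - mono_poly (b * a) s \<in> B" if "R t a" for t a b
    using ideal.subspace_scale[OF sub that[unfolded R_def], of "mono_poly b 0"]
    by (simp add: right_diff_distrib mono_poly_mult)
  define \<phi> where "\<phi> t = (if \<exists>a. R t a then THE a. R t a else 0)" for t
  have \<phi>_eq: "\<phi> t = a" if "R t a" for t a
    unfolding \<phi>_def using that R_unique by (auto intro: the_equality)
  have \<phi>_0: "\<phi> t = 0" if "\<nexists>a. R t a" for t
    using that by (simp add: \<phi>_def)
  \<comment> \<open>Reducibility to a multiple of \<open>s\<close> passes between the two terms of a binomial of \<open>B\<close>, with
    exactly the scalar that makes the functional vanish on that binomial.\<close>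
  have transfer: "R t (- (b * a / c))"
    if R: "R r a" and g: "mono_poly b r + mono_poly c t \<in> B" and "c \<noteq> 0" for a b c r t
  proof -
    have "(mono_poly b r + mono_poly c t) - (mono_poly b r - mono_poly (b * a) s) \<in> B"
      using g scaled[OF R] by (rule ideal.subspace_diff[OF sub])
    from ideal.subspace_scale[OF sub this, of "mono_poly (1 / c) 0"]
    have "mono_poly 1 t + mono_poly (b * a / c) s \<in> B"
      using \<open>c \<noteq> 0\<close> by (simp add: distrib_left mono_poly_mult)
    then show ?thesis by (simp add: R_def mono_poly_uminus)
  qed
  have "lin_ext \<phi> g = 0" if g: "g \<in> B \<inter> (monomials \<union> binomials)" for g
  proof -
    consider b t where "g = mono_poly b t" "b \<noteq> 0"
      | b c r t where "g = mono_poly b r + mono_poly c t" "b \<noteq> 0" "c \<noteq> 0"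
      using g by (auto simp: monomials_def binomials_def)
    then show ?thesis
    proof cases
      case 1
      \<comment> \<open>A term of \<open>B\<close> reduces to the zero multiple of \<open>s\<close>.\<close>
      then have "R t 0"
        using g ideal_coeff_mono_poly[OF sub] by (auto simp: R_def)
      then show ?thesis using 1 by (simp add: lin_ext_mono_poly \<phi>_eq)
    next
      case 2
      have gB: "mono_poly b r + mono_poly c t \<in> B" "mono_poly c t + mono_poly b r \<in> B"
        using g 2 by (auto simp: add.commute)
      show ?thesis
      proof (cases "\<exists>a. R r a")
        case True
        then obtain a where a: "R r a" by blast
        have "R t (- (b * a / c))" using transfer[OF a gB(1) 2(3)] .
        then show ?thesis
          using 2 a by (simp add: lin_ext_add lin_ext_mono_poly \<phi>_eq)
      next
        case False
        then have "\<nexists>a. R t a" using transfer gB(2) 2(2) by blast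
        with False show ?thesis
          using 2 by (simp add: lin_ext_add lin_ext_mono_poly \<phi>_0)
      qed
    qed
  qed
  then have "lin_ext \<phi> f = 0"
    using lin_ext_vanishes_on_binomial_ideal[OF B _ f] by blast
  moreover have "lin_ext \<phi> f = Poly_Mapping.lookup f s"
  proof -
    have "R s 1" using sub by (simp add: R_def ideal.subspace_0)
    moreover have "\<phi> t = 0" if "t \<in> Poly_Mapping.keys f - {s}" for t
      using contra that by (intro \<phi>_0) (auto simp: R_def)
    ultimately show ?thesis
      unfolding lin_ext_def by (subst sum.remove[OF _ s(1)]) (simp_all add: \<phi>_eq)
  qed
  ultimately show False using s(1) in_keys_iff[of s f] by metis
qed

section \<open>Intersection of a monomial and a binomial ideal\<close>

lemma Bin_subset: "ideal.subspace J \<Longrightarrow> Bin J \<subseteq> J"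
  unfolding Bin_def by (rule ideal.span_minimal) auto

lemma Bin_mono: "J \<subseteq> J' \<Longrightarrow> Bin J \<subseteq> Bin J'"
  unfolding Bin_def by (rule ideal.span_mono) auto

lemma binomial_ideal_Bin: "binomial_ideal (Bin J)"
  unfolding binomial_ideal_def Bin_def by (rule exI, rule conjI[OF _ refl]) simp

lemma Mon_subset: "ideal.subspace J \<Longrightarrow> Mon J \<subseteq> J"
  unfolding Mon_def by (rule ideal.span_minimal) auto

text \<open>
  Induction on the size of the support of \<open>f\<close>.  Some \<open>g = t - a r\<close> in \<open>B\<close> has all its terms in the
  support of \<open>f\<close>; since \<open>M\<close> contains the terms of its elements, \<open>g\<close> is in \<open>M\<close> as well.  Subtracting a
  multiple of \<open>g\<close> removes \<open>t\<close> from \<open>f\<close> without creating new terms.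
\<close>

lemma monomial_inter_binomial:
  fixes M B :: "('x, 'k::field) mpoly set"
  assumes M: "ideal.subspace M" and terms: "\<And>f t. f \<in> M \<Longrightarrow> t \<in> Poly_Mapping.keys f \<Longrightarrow> mono_poly 1 t \<in> M"
    and B: "binomial_ideal B"
  shows "M \<inter> B = Bin (M \<inter> B)"
proof
  note subB = binomial_ideal_subspace[OF B]
  have sub: "ideal.subspace (M \<inter> B)" using M subB by (rule ideal.subspace_inter)
  then show "Bin (M \<inter> B) \<subseteq> M \<inter> B" by (rule Bin_subset)
  have "f \<in> Bin (M \<inter> B)" if "f \<in> M \<inter> B" for f
    using that
  proof (induction "card (Poly_Mapping.keys f)" arbitrary: f rule: less_induct)
    case less
    show ?case
    proof (cases "Poly_Mapping.keys f = {}")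
      case True
      then show ?thesis by (simp add: Bin_def ideal.span_zero)
    next
      case False
      then obtain s where s: "s \<in> Poly_Mapping.keys f" by blast
      \<comment> \<open>Allowing \<open>a = 0\<close> covers the case of a monomial; \<open>r\<close> is then an arbitrary term of \<open>f\<close>.\<close>
      have "\<exists>t\<in>Poly_Mapping.keys f. \<exists>r\<in>Poly_Mapping.keys f. \<exists>a. (a = 0 \<or> r \<noteq> t) \<and> mono_poly 1 t - mono_poly a r \<in> B"
      proof (cases "mono_poly 1 s \<in> B")
        case True
        then show ?thesis using s by (intro bexI[of _ s] exI[of _ 0]) auto
      next
        case False
        then obtain t a where "t \<in> Poly_Mapping.keys f - {s}" "mono_poly 1 t - mono_poly a s \<in> B"
          using two_terms_in_binomial_ideal[OF B _ s] less.prems by blast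
        then show ?thesis using s by (intro bexI[of _ t] bexI[of _ s] exI[of _ a]) auto
      qed
      then obtain t r a where t: "t \<in> Poly_Mapping.keys f" "r \<in> Poly_Mapping.keys f" "a = 0 \<or> r \<noteq> t"
        and gB: "mono_poly 1 t - mono_poly a r \<in> B" by blast
      define g where "g = mono_poly 1 t - mono_poly a r"
      define h where "h = f - mono_poly (Poly_Mapping.lookup f t) 0 * g"
      have fM: "f \<in> M" using less.prems by simp
      have "mono_poly a 0 * mono_poly 1 r \<in> M"
        by (intro ideal.subspace_scale[OF M] terms[OF fM t(2)])
      then have "g \<in> M"
        unfolding g_def using terms[OF fM t(1)]
        by (intro ideal.subspace_diff[OF M]) (simp_all add: mono_poly_mult)
      with gB have g: "g \<in> M \<inter> B" by (simp add: g_def)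
      have "g \<in> monomials \<union> binomials"
        unfolding g_def by (rule normalized_difference_mem)
      with g have gBin: "g \<in> Bin (M \<inter> B)" unfolding Bin_def by (intro ideal.span_base) blast
      have h_eq: "h = f - (mono_poly (Poly_Mapping.lookup f t) t - mono_poly (Poly_Mapping.lookup f t * a) r)"
        by (simp add: h_def g_def right_diff_distrib mono_poly_mult)
      have "Poly_Mapping.lookup f t \<noteq> 0" "Poly_Mapping.lookup f r \<noteq> 0"
        using t(1,2) by (simp_all only: in_keys_iff not_False_eq_True)
      then have "Poly_Mapping.lookup h t = 0"
        and "\<And>x. Poly_Mapping.lookup f x = 0 \<Longrightarrow> Poly_Mapping.lookup h x = 0"
        using t(3) by (auto simp: h_eq lookup_minus lookup_mono_poly when_def)
      then have "Poly_Mapping.keys h \<subseteq> Poly_Mapping.keys f - {t}"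
        by (metis Diff_iff in_keys_iff singletonD subsetI)
      then have "Poly_Mapping.keys h \<subset> Poly_Mapping.keys f" using t(1) by blast
      then have "card (Poly_Mapping.keys h) < card (Poly_Mapping.keys f)" by (simp add: psubset_card_mono)
      moreover have "h \<in> M \<inter> B"
        unfolding h_def using less.prems g
        by (intro ideal.subspace_diff[OF sub] ideal.subspace_scale[OF sub])
      ultimately have "h \<in> Bin (M \<inter> B)" using less.hyps by blast
      moreover have "f = h + mono_poly (Poly_Mapping.lookup f t) 0 * g" by (simp add: h_def)
      ultimately show ?thesis
        using gBin unfolding Bin_def by (metis ideal.span_add ideal.span_scale)
    qed
  qed
  then show "M \<inter> B \<subseteq> Bin (M \<inter> B)" by blast
qed

lemma Mon_terms:
  fixes J :: "('x, 'k::field) mpoly set"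
  assumes J: "ideal.subspace J" and "f \<in> Mon J" "t \<in> Poly_Mapping.keys f"
  shows "mono_poly 1 t \<in> Mon J"
proof -
  have "\<forall>t\<in>Poly_Mapping.keys f. mono_poly 1 t \<in> Mon J"
    using assms(2) unfolding Mon_def
  proof (induction rule: ideal.span_induct_alt)
    case base
    then show ?case by simp
  next
    case (step c x y)
    obtain a s where x: "x = mono_poly a s" "a \<noteq> 0" "x \<in> J"
      using step.hyps by (auto simp: monomials_def)
    have "mono_poly 1 s \<in> ideal.span (J \<inter> monomials)"
    proof (rule ideal.span_base)
      show "mono_poly 1 s \<in> J \<inter> monomials"
        using x ideal_coeff_mono_poly[OF J, of a s 1] by (auto simp: monomials_def)
    qed
    then have mult: "mono_poly 1 (r + s) \<in> ideal.span (J \<inter> monomials)" for r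
      using ideal.span_scale[of "mono_poly 1 s" _ "mono_poly 1 r"] by (simp add: mono_poly_mult)
    have "Poly_Mapping.keys (c * x) \<subseteq> {r + s | r. True}"
      using keys_mult[of c x] by (auto simp: x mono_poly_def split: if_splits)
    then show ?case using step.IH mult keys_add[of "c * x" y] by blast
  qed
  with assms(3) show ?thesis by blast
qed

section \<open>Sums of ideals\<close>

lemma ideal_sum_span:
  "ideal_sum (\<lambda>i. ideal.span (G i)) A = ideal.span (\<Union>i\<in>A. G i)"
  unfolding ideal_sum_def
proof (rule antisym; rule ideal.span_minimal)
  show "(\<Union>i\<in>A. ideal.span (G i)) \<subseteq> ideal.span (\<Union>i\<in>A. G i)"
    by (auto intro: subsetD[OF ideal.span_mono, rotated])
  show "(\<Union>i\<in>A. G i) \<subseteq> ideal.span (\<Union>i\<in>A. ideal.span (G i))"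
    by (auto intro!: ideal.span_base)
qed auto

lemma ideal_sum_upper: "i \<in> A \<Longrightarrow> F i \<subseteq> ideal_sum F A"
  unfolding ideal_sum_def by (auto intro: ideal.span_base)

lemma ideal_sum_least:
  assumes "ideal.subspace J" "\<And>i. i \<in> A \<Longrightarrow> F i \<subseteq> J"
  shows "ideal_sum F A \<subseteq> J"
  unfolding ideal_sum_def using assms by (intro ideal.span_minimal) auto

lemma binomial_ideal_sum:
  assumes "\<And>i. i \<in> A \<Longrightarrow> binomial_ideal (F i)"
  shows "binomial_ideal (ideal_sum F A)"
proof -
  obtain G where G: "\<And>i. i \<in> A \<Longrightarrow> G i \<subseteq> monomials \<union> binomials \<and> F i = ideal.span (G i)"
    using assms unfolding binomial_ideal_def by metis
  have "ideal_sum F A = ideal_sum (\<lambda>i. ideal.span (G i)) A"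
    unfolding ideal_sum_def using G by simp
  with G show ?thesis
    unfolding binomial_ideal_def ideal_sum_span by (intro exI[of _ "\<Union>i\<in>A. G i"]) blast
qed

lemma Bin_st_binomial:
  fixes J :: "('x, 'k::field) mpoly set"
  shows "binomial_ideal (Bin_st Y s t J)"
  unfolding binomial_ideal_def Bin_st_def
  by (rule exI, rule conjI[OF _ refl]) (use normalized_difference_mem in fast)

lemma Bin_st_subset: "ideal.subspace J \<Longrightarrow> Bin_st Y s t J \<subseteq> J"
  unfolding Bin_st_def by (rule ideal.span_minimal) auto

section \<open>Splitting terms and bounding exponents\<close>

definition restrict_term :: "'x set \<Rightarrow> 'x::finite expo \<Rightarrow> 'x expo" where
  "restrict_term Y t = Abs_poly_mapping (\<lambda>x. Poly_Mapping.lookup t x when x \<in> Y)"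

lemma lookup_restrict_term:
  "Poly_Mapping.lookup (restrict_term Y t) x = (Poly_Mapping.lookup t x when x \<in> Y)"
  unfolding restrict_term_def by (subst lookup_Abs_poly_mapping) simp_all

lemma restrict_term_in: "restrict_term Y t \<in> terms_in Y"
  unfolding terms_in_def by (auto simp: lookup_restrict_term when_def simp flip: lookup_not_eq_zero_eq_in_keys split: if_splits)

lemma restrict_term_split: "restrict_term (- Y) t + restrict_term Y t = t"
  by (rule poly_mapping_eqI) (simp add: lookup_add lookup_restrict_term when_def)

lemma Var_power: "Var x ^ d = mono_poly 1 (Poly_Mapping.single x d)"
proof (induction d)
  case 0
  then show ?case by (simp add: mono_poly_def)
next
  case (Suc d)
  then show ?case by (simp add: Var_def mono_poly_mult flip: single_add)
qed

lemma Var_power_mem_term: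
  fixes J :: "('x, 'k::field) mpoly set"
  assumes "ideal.subspace J" "Var x ^ d \<in> J" "d \<le> Poly_Mapping.lookup t x"
  shows "mono_poly 1 t \<in> J"
proof -
  have "t = (t - Poly_Mapping.single x d) + Poly_Mapping.single x d"
    using assms(3) by (intro poly_mapping_eqI) (auto simp: lookup_add lookup_minus lookup_single when_def)
  then have "mono_poly (1::'k) t = mono_poly 1 (t - Poly_Mapping.single x d) * Var x ^ d"
    by (metis Var_power mono_poly_mult mult_1)
  then show ?thesis using assms by (simp add: ideal.subspace_scale)
qed

text \<open>
  The least number in the definition of \<open>delta\<close> is taken over a nonempty set: a sum of individual
  exponents, one for each component, works for all components at once.
\<close>

lemma delta_spec:
  fixes Is :: "nat \<Rightarrow> ('x::finite, 'k::field) mpoly set"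
  assumes cell: "\<And>i. i \<in> {1..k} \<Longrightarrow> cellular (Ys i) (Is i)"
    and "j \<in> {1..k}" "x \<notin> Ys j"
  shows "Var x ^ delta k Is Ys x \<in> Is j"
proof -
  have "\<forall>i\<in>{1..k}. \<exists>d. x \<notin> Ys i \<longrightarrow> Var x ^ d \<in> Is i"
    using cell unfolding cellular_def by blast
  from bchoice[OF this] obtain d
    where d: "\<And>i. i \<in> {1..k} \<Longrightarrow> x \<notin> Ys i \<Longrightarrow> Var x ^ d i \<in> Is i" by blast
  \<comment> \<open>The successor makes the exponent positive even if all the summands vanish.\<close>
  define D where "D = Suc (\<Sum>i\<in>{1..k}. d i)"
  have "Var x ^ D \<in> Is i" if "i \<in> {1..k}" "x \<notin> Ys i" for i
  proof -
    have "d i \<le> D" unfolding D_def using member_le_sum[OF that(1), of d] by simp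
    then have "(Var x :: ('x, 'k) mpoly) ^ D = Var x ^ (D - d i) * Var x ^ d i"
      by (simp flip: power_add)
    then show ?thesis
      using d[OF that] cell[OF that(1)] by (simp add: cellular_def ideal.subspace_scale)
  qed
  then have "0 < D \<and> (\<forall>j\<in>{1..k}. x \<notin> Ys j \<longrightarrow> Var x ^ D \<in> Is j)" by (simp add: D_def)
  from LeastI[where P = "\<lambda>d. 0 < d \<and> (\<forall>j\<in>{1..k}. x \<notin> Ys j \<longrightarrow> Var x ^ d \<in> Is j)", OF this] assms(2,3)
  show ?thesis unfolding delta_def by blast
qed

section \<open>The ideals of the procedure\<close>

lemma step_ideal_eq_Bin:
  fixes Is :: "nat \<Rightarrow> ('x, 'k::field) mpoly set"
  assumes "\<And>i. i \<in> {1..k} \<Longrightarrow> ideal.subspace (Is i)"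
  shows "step_ideal k Is Ys Y = Bin (step_ideal k Is Ys Y)"
  unfolding step_ideal_def
proof (rule monomial_inter_binomial)
  show "ideal.subspace (M_part k Is Ys Y)"
    unfolding M_part_def Mon_def by (intro ideal.subspace_Int) auto
  show "mono_poly 1 t \<in> M_part k Is Ys Y" if "f \<in> M_part k Is Ys Y" "t \<in> Poly_Mapping.keys f" for f t
    using that assms unfolding M_part_def by (auto intro: Mon_terms)
  show "binomial_ideal (ideal_sum (\<lambda>(s, t). Bin_st Y s t (J_part k Is Ys Y))
      (T_terms k Is Ys Y \<times> T_terms k Is Ys Y))"
    by (intro binomial_ideal_sum) (auto intro: Bin_st_binomial)
qed

lemma step_ideal_subset:
  fixes Is :: "nat \<Rightarrow> ('x, 'k::field) mpoly set"
  assumes sub: "\<And>i. i \<in> {1..k} \<Longrightarrow> ideal.subspace (Is i)"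
  shows "step_ideal k Is Ys Y \<subseteq> (\<Inter>i\<in>{1..k}. Is i)"
proof -
  have "M_part k Is Ys Y \<subseteq> Is i" if "i \<in> {1..k}" "\<not> Y \<subseteq> Ys i" for i
    using that Mon_subset[OF sub[OF that(1)]] unfolding M_part_def by blast
  moreover have "ideal.subspace (J_part k Is Ys Y)"
    unfolding J_part_def using sub by (intro ideal.subspace_Int) auto
  then have "ideal_sum (\<lambda>(s, t). Bin_st Y s t (J_part k Is Ys Y))
      (T_terms k Is Ys Y \<times> T_terms k Is Ys Y) \<subseteq> J_part k Is Ys Y"
    by (intro ideal_sum_least) (auto dest: Bin_st_subset)
  moreover have "J_part k Is Ys Y \<subseteq> Is i" if "i \<in> {1..k}" "Y \<subseteq> Ys i" for i
    using that unfolding J_part_def by blast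
  ultimately show ?thesis unfolding step_ideal_def by blast
qed

text \<open>
  The case \<open>a = 0\<close> is included so that monomials can be treated in the same way as binomials.
\<close>

lemma mem_step_ideal:
  fixes Is :: "nat \<Rightarrow> ('x::finite, 'k::field) mpoly set"
  assumes sub: "\<And>i. i \<in> {1..k} \<Longrightarrow> ideal.subspace (Is i)"
    and g: "mono_poly 1 s - mono_poly a t \<in> (\<Inter>i\<in>{1..k}. Is i)"
    and outside: "\<And>i. i \<in> {1..k} \<Longrightarrow> \<not> Y \<subseteq> Ys i \<Longrightarrow> mono_poly 1 s \<in> Is i \<and> mono_poly 1 t \<in> Is i"
    and small: "\<And>x. x \<notin> Y \<Longrightarrow> Poly_Mapping.lookup s x < delta k Is Ys x \<and> Poly_Mapping.lookup t x < delta k Is Ys x"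
  shows "mono_poly 1 s - mono_poly a t \<in> step_ideal k Is Ys Y"
  unfolding step_ideal_def
proof
  let ?g = "mono_poly 1 s - mono_poly a t"
  show "?g \<in> M_part k Is Ys Y"
    unfolding M_part_def
  proof (rule INT_I)
    fix i assume "i \<in> {i \<in> {1..k}. \<not> Y \<subseteq> Ys i}"
    then have "mono_poly 1 s \<in> Is i" "mono_poly 1 t \<in> Is i" using outside by auto
    then have "mono_poly 1 s \<in> Mon (Is i)" "mono_poly 1 t \<in> Mon (Is i)"
      unfolding Mon_def monomials_def by (auto intro!: ideal.span_base)
    then have "mono_poly 1 s - mono_poly a 0 * mono_poly 1 t \<in> Mon (Is i)"
      unfolding Mon_def by (intro ideal.span_diff ideal.span_scale)
    then show "?g \<in> Mon (Is i)" by (simp add: mono_poly_mult)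
  qed
  let ?s = "restrict_term (- Y) s" and ?t = "restrict_term (- Y) t"
  have T: "?s \<in> T_terms k Is Ys Y" "?t \<in> T_terms k Is Ys Y"
    unfolding T_terms_def using small by (auto simp: restrict_term_in lookup_restrict_term)
  have "?g = mono_poly 1 (?s + restrict_term Y s) - mono_poly a (restrict_term Y t + ?t)"
    by (simp add: restrict_term_split add.commute[of "restrict_term Y t"])
  moreover have "?g \<in> J_part k Is Ys Y" using g unfolding J_part_def by blast
  ultimately have "?g \<in> Bin_st Y ?s ?t (J_part k Is Ys Y)"
    unfolding Bin_st_def by (intro ideal.span_base) (use restrict_term_in in blast)
  then show "?g \<in> ideal_sum (\<lambda>(s, t). Bin_st Y s t (J_part k Is Ys Y))
      (T_terms k Is Ys Y \<times> T_terms k Is Ys Y)"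
    using ideal_sum_upper[of "(?s, ?t)" "T_terms k Is Ys Y \<times> T_terms k Is Ys Y"
        "\<lambda>(s, t). Bin_st Y s t (J_part k Is Ys Y)"] T by auto
qed

text \<open>
  The set \<open>S\<close> collects the cell variable sets of the components that do not contain \<open>s\<close>.  As \<open>a\<close> is
  invertible, these are also the components that do not contain \<open>t\<close>, so one choice of \<open>S\<close> bounds the
  exponents of both terms.
\<close>

lemma binomial_mem_some_step_ideal:
  fixes Is :: "nat \<Rightarrow> ('x::finite, 'k::field) mpoly set"
  assumes cell: "\<And>i. i \<in> {1..k} \<Longrightarrow> cellular (Ys i) (Is i)"
    and g: "mono_poly 1 s - mono_poly a t \<in> (\<Inter>i\<in>{1..k}. Is i)" and "a \<noteq> 0"
  shows "\<exists>S \<subseteq> Ys ` {1..k}. mono_poly 1 s - mono_poly a t \<in> step_ideal k Is Ys (\<Inter>S)"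
proof -
  have sub: "ideal.subspace (Is i)" if "i \<in> {1..k}" for i
    using cell[OF that] by (simp add: cellular_def)
  have iff: "mono_poly 1 s \<in> Is i \<longleftrightarrow> mono_poly 1 t \<in> Is i" if i: "i \<in> {1..k}" for i
  proof -
    have gi: "mono_poly 1 s - mono_poly a t \<in> Is i" using g i by blast
    have "mono_poly 1 s \<in> Is i \<longleftrightarrow> mono_poly a t \<in> Is i"
      using ideal.subspace_diff[OF sub[OF i] _ gi, of "mono_poly 1 s"]
        ideal.subspace_add[OF sub[OF i] gi, of "mono_poly a t"] by auto
    also have "\<dots> \<longleftrightarrow> mono_poly 1 t \<in> Is i"
      using ideal_coeff_mono_poly[OF sub[OF i]] \<open>a \<noteq> 0\<close> by (metis zero_neq_one)
    finally show ?thesis .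
  qed
  define S where "S = Ys ` {i \<in> {1..k}. mono_poly 1 s \<notin> Is i}"
  have "mono_poly 1 s - mono_poly a t \<in> step_ideal k Is Ys (\<Inter>S)"
  proof (rule mem_step_ideal[OF sub g])
    show "mono_poly 1 s \<in> Is i \<and> mono_poly 1 t \<in> Is i"
      if "i \<in> {1..k}" "\<not> \<Inter>S \<subseteq> Ys i" for i
      using that iff[OF that(1)] unfolding S_def by blast
    show "Poly_Mapping.lookup s x < delta k Is Ys x \<and> Poly_Mapping.lookup t x < delta k Is Ys x" if "x \<notin> \<Inter>S" for x
    proof -
      obtain i where i: "i \<in> {1..k}" "x \<notin> Ys i" "mono_poly 1 s \<notin> Is i"
        using \<open>x \<notin> \<Inter>S\<close> unfolding S_def by blast
      have "Var x ^ delta k Is Ys x \<in> Is i"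
        using cell i(1,2) by (rule delta_spec)
      note pow = Var_power_mem_term[OF sub[OF i(1)] this]
      show ?thesis using pow iff[OF i(1)] i(3) by (meson not_le)
    qed
  qed
  moreover have "S \<subseteq> Ys ` {1..k}" unfolding S_def by blast
  ultimately show ?thesis by blast
qed

section \<open>The binomial part as a sum\<close>

theorem mainTheorem1:
  fixes I :: "('x::finite, 'k::field) mpoly set"
    and k :: nat
    and Is :: "nat \<Rightarrow> ('x, 'k) mpoly set"
    and Ys :: "nat \<Rightarrow> 'x set"
  assumes "ideal.subspace I"
    and "I = (\<Inter>i\<in>{1..k}. Is i)"
    and "\<And>i. i \<in> {1..k} \<Longrightarrow> cellular (Ys i) (Is i)"
  shows "(\<forall>S \<subseteq> Ys ` {1..k}. binomial_ideal (step_ideal k Is Ys (\<Inter>S))) \<and>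
    (\<forall>B. procedure_output k Is Ys B \<longrightarrow> ideal.span (set B) = Bin I) \<and>
    Bin I = ideal_sum
      (\<lambda>Y. M_part k Is Ys Y \<inter>
        ideal_sum (\<lambda>(s, t). Bin_st Y s t (J_part k Is Ys Y)) (T_terms k Is Ys Y \<times> T_terms k Is Ys Y))
      {\<Inter>S | S. S \<subseteq> Ys ` {1..k}}"
proof -
  let ?step = "step_ideal k Is Ys"
  let ?sum = "ideal_sum ?step {\<Inter>S | S. S \<subseteq> Ys ` {1..k}}"
  have sub: "ideal.subspace (Is i)" if "i \<in> {1..k}" for i
    using assms(3)[OF that] by (simp add: cellular_def)
  have step_Bin: "?step Y = Bin (?step Y)" for Y
    using sub by (rule step_ideal_eq_Bin)
  have bin: "binomial_ideal (?step Y)" for Y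
    by (subst step_Bin) (rule binomial_ideal_Bin)
  have "?sum \<subseteq> Bin I"
  proof (rule ideal_sum_least)
    show "ideal.subspace (Bin I)" by (simp add: Bin_def)
    show "?step Y \<subseteq> Bin I" for Y
    proof (subst step_Bin)
      have "?step Y \<subseteq> I" unfolding assms(2) using sub by (rule step_ideal_subset)
      then show "Bin (?step Y) \<subseteq> Bin I" by (rule Bin_mono)
    qed
  qed
  moreover have "Bin I \<subseteq> ?sum"
    unfolding Bin_def
  proof (rule ideal.span_minimal)
    show sum: "ideal.subspace ?sum" by (simp add: ideal_sum_def)
    have step: "f \<in> ?sum" if "f \<in> ?step (\<Inter>S)" "S \<subseteq> Ys ` {1..k}" for f S
    proof -
      have "\<Inter>S \<in> {\<Inter>S | S. S \<subseteq> Ys ` {1..k}}" using that(2) by blast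
      then have "?step (\<Inter>S) \<subseteq> ?sum" by (rule ideal_sum_upper)
      with that(1) show ?thesis by (rule rev_subsetD)
    qed
    have mon: "mono_poly a t \<in> ?sum" if "mono_poly a t \<in> I" for a t
    proof (cases "a = 0")
      case True
      then show ?thesis using sum by (simp add: ideal.subspace_0)
    next
      case False
      then have I1: "mono_poly 1 t \<in> I"
        using ideal_coeff_mono_poly[OF assms(1) that] by blast
      then have "mono_poly 1 t \<in> Is i" if "i \<in> {1..k}" for i
        using that unfolding assms(2) by blast
      \<comment> \<open>For \<open>Y = X\<close> no exponent has to be bounded, and every component contains \<open>t\<close>.\<close>
      then have "mono_poly 1 t - mono_poly 0 t \<in> ?step (\<Inter>{})"
        using I1[unfolded assms(2)] by (intro mem_step_ideal[OF sub]) simp_all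
      then have "mono_poly 1 t - mono_poly 0 t \<in> ?sum" by (rule step) simp
      then have "mono_poly 1 t \<in> ?sum" by simp
      then show ?thesis by (rule ideal_coeff_mono_poly[OF sum]) simp
    qed
    show "I \<inter> (monomials \<union> binomials) \<subseteq> ?sum"
    proof
      fix f assume f: "f \<in> I \<inter> (monomials \<union> binomials)"
      then consider a t where "f = mono_poly a t"
        | a b s t where "f = mono_poly a s + mono_poly b t" "a \<noteq> 0" "b \<noteq> 0"
        by (auto simp: monomials_def binomials_def)
      then show "f \<in> ?sum"
      proof cases
        case 1
        then show ?thesis using f mon by simp
      next
        case 2
        \<comment> \<open>Dividing by the first coefficient gives a generator of the shape used in \<open>Bin_st\<close>.\<close>
        let ?g = "mono_poly 1 s - mono_poly (- b / a) t"
        have g: "?g = mono_poly (1 / a) 0 * f" and f_eq: "f = mono_poly a 0 * ?g"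
          using 2 by (simp_all add: distrib_left right_diff_distrib mono_poly_mult mono_poly_uminus)
        have "?g \<in> I" unfolding g using f by (intro ideal.subspace_scale[OF assms(1)]) blast
        then have "?g \<in> (\<Inter>i\<in>{1..k}. Is i)" unfolding assms(2) .
        moreover have "- b / a \<noteq> 0" using 2 by simp
        ultimately have "\<exists>S \<subseteq> Ys ` {1..k}. ?g \<in> ?step (\<Inter>S)"
          using assms(3) by (intro binomial_mem_some_step_ideal)
        then obtain S where S: "S \<subseteq> Ys ` {1..k}" "?g \<in> ?step (\<Inter>S)" by blast
        from S(2,1) have "?g \<in> ?sum" by (rule step)
        then show ?thesis by (subst f_eq) (rule ideal.subspace_scale[OF sum])
      qed
    qed
  qed
  ultimately have main: "Bin I = ?sum" by blast
  have "ideal.span (set B) = Bin I" if "procedure_output k Is Ys B" for B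
  proof -
    obtain Ss G where Ss: "set Ss = Pow (Ys ` {1..k})"
      and G: "\<And>S. S \<in> set Ss \<Longrightarrow> ideal.span (set (G S)) = ?step (\<Inter>S)"
      and B: "B = concat (map G Ss)"
      using \<open>procedure_output k Is Ys B\<close> unfolding procedure_output_def by blast
    have "ideal.span (set B) = ideal_sum (\<lambda>S. ideal.span (set (G S))) (set Ss)"
      by (simp add: B ideal_sum_span)
    also have "\<dots> = ideal.span (\<Union>S\<in>set Ss. ?step (\<Inter>S))"
      unfolding ideal_sum_def using G by simp
    also have "(\<Union>S\<in>set Ss. ?step (\<Inter>S)) = (\<Union>Y\<in>{\<Inter>S | S. S \<subseteq> Ys ` {1..k}}. ?step Y)"
      unfolding Ss by blast
    finally show ?thesis unfolding main ideal_sum_def .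
  qed
  then show ?thesis
    using bin main unfolding step_ideal_def[abs_def] by (intro conjI allI impI) simp_all
qed

end
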